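(* Let $I$ be a finite set and $\mathcal X$ a non-empty collection of subsets of $I$ such that any two elements of $\mathcal X$ have at most one common element. For the matrix $Q(\mathcal X)$, with decomposition $Q(\mathcal X)=\bigoplus_{K\in\Pi}Q_K$ into indecomposable principal submatrices, there are precisely two possibilities: (i) for every $K\in\Pi$, $Q_K$ is finite or affine; (ii) for a unique $K_0\in\Pi$, $Q_{K_0}$ is indefinite, and $Q_K$ is finite for every other $K\in\Pi$.
   Context: Let $J$ be the $|\mathcal X|\times|I|$ incidence matrix of $\mathcal X$ ($J_{X,i}=1$ if $i\in X$ and $0$ otherwise), $E$ the $|I|\times|I|$ matrix with all entries $1$, and $Q(\mathcal X)=J^tJ-E$. This is a symmetric integer matrix whose off-diagonal entries are $0$ or $-1$. $\Pi$ is the partition of $I$ into connected components of the graph on $I$ whose edges are the pairs $\{i,j\}$ not contained in any $X\in\mathcal X$; $Q_K$ is the principal submatrix of $Q(\mathcal X)$ on the rows and columns indexed by $K$. By Vinberg's classification each $m\times m$ matrix $Q_K$ is of exactly one of three types: finite (positive definite); affine (positive semidefinite of rank $m-1$ with null space spanned by a vector with all coordinates positive); indefinite (there is a real vector $u$ with all coordinates positive such that all coordinates of $Q_Ku$ are negative). *)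

theory Defs
  imports Complex_Main "HOL-Library.Function_Algebras" "HOL-Library.Disjoint_Sets"
begin

text \<open>
  Matrices with rows and columns indexed by a finite set \<open>K\<close> are functions \<open>'a \<Rightarrow> 'a \<Rightarrow> _\<close> of which
  only the values on \<open>K \<times> K\<close> are used, so the principal submatrix of \<open>A\<close> on \<open>K\<close> is
  the pair of \<open>K\<close> and the same function \<open>A\<close>. Real vectors indexed by \<open>K\<close> are functions vanishing
  outside \<open>K\<close>, which makes them a subspace of the real vector space \<open>'a \<Rightarrow> real\<close>.
\<close>

definition fun_scale :: "real \<Rightarrow> ('a \<Rightarrow> real) \<Rightarrow> 'a \<Rightarrow> real" where
  "fun_scale c v = (\<lambda>i. c * v i)"

global_interpretation fun_space: vector_space fun_scale
  by unfold_locales (auto simp: fun_scale_def fun_eq_iff algebra_simps)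

definition vecs :: "'a set \<Rightarrow> ('a \<Rightarrow> real) set" where
  "vecs K = {v. \<forall>i. i \<notin> K \<longrightarrow> v i = 0}"

definition mat_vec :: "'a set \<Rightarrow> ('a \<Rightarrow> 'a \<Rightarrow> real) \<Rightarrow> ('a \<Rightarrow> real) \<Rightarrow> 'a \<Rightarrow> real" where
  "mat_vec K A v = (\<lambda>i. if i \<in> K then \<Sum>j\<in>K. A i j * v j else 0)"

definition quad_form :: "'a set \<Rightarrow> ('a \<Rightarrow> 'a \<Rightarrow> real) \<Rightarrow> ('a \<Rightarrow> real) \<Rightarrow> real" where
  "quad_form K A v = (\<Sum>i\<in>K. v i * mat_vec K A v i)"

definition mat_column :: "'a set \<Rightarrow> ('a \<Rightarrow> 'a \<Rightarrow> real) \<Rightarrow> 'a \<Rightarrow> 'a \<Rightarrow> real" where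
  "mat_column K A j = (\<lambda>i. if i \<in> K then A i j else 0)"

definition mat_rank :: "'a set \<Rightarrow> ('a \<Rightarrow> 'a \<Rightarrow> real) \<Rightarrow> nat" where
  "mat_rank K A = fun_space.dim (mat_column K A ` K)"

definition null_space :: "'a set \<Rightarrow> ('a \<Rightarrow> 'a \<Rightarrow> real) \<Rightarrow> ('a \<Rightarrow> real) set" where
  "null_space K A = {v \<in> vecs K. mat_vec K A v = 0}"

definition pos_def :: "'a set \<Rightarrow> ('a \<Rightarrow> 'a \<Rightarrow> real) \<Rightarrow> bool" where
  "pos_def K A \<longleftrightarrow> (\<forall>v\<in>vecs K. v \<noteq> 0 \<longrightarrow> quad_form K A v > 0)"

definition pos_semidef :: "'a set \<Rightarrow> ('a \<Rightarrow> 'a \<Rightarrow> real) \<Rightarrow> bool" where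
  "pos_semidef K A \<longleftrightarrow> (\<forall>v\<in>vecs K. quad_form K A v \<ge> 0)"

text \<open>
  Vinberg's three types. The rank condition for affine
  type is stated additively because subtraction on \<open>nat\<close> is truncated.
\<close>

definition finite_type :: "'a set \<Rightarrow> ('a \<Rightarrow> 'a \<Rightarrow> real) \<Rightarrow> bool" where
  "finite_type K A \<longleftrightarrow> pos_def K A"

definition affine_type :: "'a set \<Rightarrow> ('a \<Rightarrow> 'a \<Rightarrow> real) \<Rightarrow> bool" where
  "affine_type K A \<longleftrightarrow>
     pos_semidef K A \<and> mat_rank K A + 1 = card K \<and>
     (\<exists>u\<in>vecs K. (\<forall>i\<in>K. u i > 0) \<and> null_space K A = fun_space.span {u})"

definition indefinite_type :: "'a set \<Rightarrow> ('a \<Rightarrow> 'a \<Rightarrow> real) \<Rightarrow> bool" where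
  "indefinite_type K A \<longleftrightarrow>
     (\<exists>u\<in>vecs K. (\<forall>i\<in>K. u i > 0) \<and> (\<forall>i\<in>K. mat_vec K A u i < 0))"

definition incidence :: "'a set \<Rightarrow> 'a \<Rightarrow> int" where
  "incidence X i = (if i \<in> X then 1 else 0)"

text \<open>The entries of \<open>J\<^sup>tJ - E\<close>, where \<open>J\<close> has rows indexed by \<open>\<X>\<close> and \<open>E\<close> is the all-ones matrix.\<close>

definition Q_int :: "'a set set \<Rightarrow> 'a \<Rightarrow> 'a \<Rightarrow> int" where
  "Q_int \<X> i j = (\<Sum>X\<in>\<X>. incidence X i * incidence X j) - 1"

definition Q_mat :: "'a set set \<Rightarrow> 'a \<Rightarrow> 'a \<Rightarrow> real" where
  "Q_mat \<X> i j = of_int (Q_int \<X> i j)"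

definition edges :: "'a set \<Rightarrow> 'a set set \<Rightarrow> ('a \<times> 'a) set" where
  "edges I \<X> = {(i, j). i \<in> I \<and> j \<in> I \<and> i \<noteq> j \<and> \<not> (\<exists>X\<in>\<X>. {i, j} \<subseteq> X)}"

text \<open>
  The edge relation is symmetric and contained in \<open>I \<times> I\<close>, so its reflexive transitive closure
  restricts to an equivalence relation on \<open>I\<close> whose classes are the connected components.
\<close>

definition components :: "'a set \<Rightarrow> 'a set set \<Rightarrow> 'a set set" where
  "components I \<X> = I // (edges I \<X>)\<^sup>*"

definition indecomposable :: "'a set \<Rightarrow> ('a \<Rightarrow> 'a \<Rightarrow> real) \<Rightarrow> bool" where
  "indecomposable K A \<longleftrightarrow> K \<noteq> {} \<and>
     \<not> (\<exists>S T. S \<noteq> {} \<and> T \<noteq> {} \<and> S \<inter> T = {} \<and> S \<union> T = K \<and>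
           (\<forall>i\<in>S. \<forall>j\<in>T. A i j = 0 \<and> A j i = 0))"

text \<open>
  The remaining facts justify that \<open>components I \<X>\<close> gives the decomposition of \<open>Q_mat \<X>\<close> into
  indecomposable principal submatrices.
\<close>

lemma Q_mat_sym: "Q_mat \<X> i j = Q_mat \<X> j i"
  by (simp add: Q_mat_def Q_int_def mult.commute)

lemma Q_mat_offdiag:
  assumes "finite I" "\<X> \<subseteq> Pow I" "pairwise (\<lambda>X Y. card (X \<inter> Y) \<le> 1) \<X>"
    and "i \<in> I" "j \<in> I" "i \<noteq> j"
  shows "Q_mat \<X> i j = (if (i, j) \<in> edges I \<X> then - 1 else 0)"
proof (cases "\<exists>X\<in>\<X>. {i, j} \<subseteq> X")
  case True
  then obtain X where X: "X \<in> \<X>" "i \<in> X" "j \<in> X" by auto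
  have fin: "finite \<X>" using assms(1,2) by (meson finite_Pow_iff finite_subset)
  have uniq: "Y = X" if Y: "Y \<in> \<X>" "i \<in> Y" "j \<in> Y" for Y
  proof (rule ccontr)
    assume "Y \<noteq> X"
    then have le: "card (X \<inter> Y) \<le> 1"
      using pairwiseD[OF assms(3) X(1) Y(1)] by simp
    have "finite X" using X(1) assms(1,2) by (auto intro: finite_subset)
    then have "finite (X \<inter> Y)" by simp
    moreover have "{i, j} \<subseteq> X \<inter> Y" using X Y by simp
    ultimately have "card {i, j} \<le> card (X \<inter> Y)" by (rule card_mono)
    with le show False using assms(6) by simp
  qed
  have "(\<Sum>Y\<in>\<X>. incidence Y i * incidence Y j) = (\<Sum>Y\<in>\<X>. if Y = X then 1 else 0)"
  proof (rule sum.cong)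
    fix Y assume "Y \<in> \<X>"
    then have "i \<in> Y \<and> j \<in> Y \<longleftrightarrow> Y = X" using uniq X by blast
    then show "incidence Y i * incidence Y j = (if Y = X then 1 else 0)"
      by (auto simp: incidence_def)
  qed simp
  also have "\<dots> = 1" using fin X(1) by simp
  finally show ?thesis using True by (auto simp: Q_mat_def Q_int_def edges_def)
next
  case False
  then have "(\<Sum>Y\<in>\<X>. incidence Y i * incidence Y j) = 0"
    by (intro sum.neutral) (auto simp: incidence_def)
  then show ?thesis using False assms(4-6) by (auto simp: Q_mat_def Q_int_def edges_def)
qed

lemma edges_rtrancl_sym: "sym ((edges I \<X>)\<^sup>*)"
  by (intro sym_rtrancl) (auto simp: sym_def edges_def insert_commute)

lemma edges_rtrancl_subset: "(i, j) \<in> (edges I \<X>)\<^sup>* \<Longrightarrow> i \<in> I \<Longrightarrow> j \<in> I"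
  by (induction rule: rtrancl_induct) (auto simp: edges_def)

lemma components_eq: "components I \<X> = I // ((edges I \<X>)\<^sup>* \<inter> I \<times> I)"
proof -
  have "(edges I \<X>)\<^sup>* `` {a} = ((edges I \<X>)\<^sup>* \<inter> I \<times> I) `` {a}" if "a \<in> I" for a
    using that edges_rtrancl_subset[of a _ I \<X>] by auto
  then show ?thesis unfolding components_def quotient_def by simp
qed

lemma partition_on_components: "partition_on I (components I \<X>)"
proof -
  have "equiv I ((edges I \<X>)\<^sup>* \<inter> I \<times> I)"
    using edges_rtrancl_sym[of I \<X>]
    by (intro equivI) (auto simp: refl_on_def sym_def trans_def)
  then show ?thesis unfolding components_eq by (rule partition_on_quotient)
qed

lemma Q_mat_block:
  assumes "finite I" "\<X> \<subseteq> Pow I" "pairwise (\<lambda>X Y. card (X \<inter> Y) \<le> 1) \<X>"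
    and K: "K \<in> components I \<X>" and L: "L \<in> components I \<X>" and "K \<noteq> L" "i \<in> K" "j \<in> L"
  shows "Q_mat \<X> i j = 0"
proof -
  obtain a b where a: "a \<in> I" "K = (edges I \<X>)\<^sup>* `` {a}" and b: "b \<in> I" "L = (edges I \<X>)\<^sup>* `` {b}"
    using K L unfolding components_def by (auto elim!: quotientE)
  have ij: "i \<in> I" "j \<in> I"
    using \<open>i \<in> K\<close> \<open>j \<in> L\<close> edges_rtrancl_subset[of a i I \<X>] edges_rtrancl_subset[of b j I \<X>]
    unfolding a(2) b(2) by (simp_all add: a(1) b(1))
  have disj: "K \<inter> L = {}"
    using partition_onD2[OF partition_on_components[of I \<X>]] K L \<open>K \<noteq> L\<close>
    by (auto simp: disjoint_def)
  have "(i, j) \<notin> edges I \<X>"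
  proof
    assume "(i, j) \<in> edges I \<X>"
    then have "j \<in> K" using \<open>i \<in> K\<close> a by (auto intro: rtrancl_into_rtrancl)
    then show False using disj \<open>j \<in> L\<close> by auto
  qed
  moreover have "i \<noteq> j" using disj \<open>i \<in> K\<close> \<open>j \<in> L\<close> by blast
  ultimately show ?thesis using Q_mat_offdiag[OF assms(1-3) ij] by simp
qed

lemma indecomposable_components:
  assumes "finite I" "\<X> \<subseteq> Pow I" "pairwise (\<lambda>X Y. card (X \<inter> Y) \<le> 1) \<X>"
    and K: "K \<in> components I \<X>"
  shows "indecomposable K (Q_mat \<X>)"
proof -
  obtain a where a: "a \<in> I" "K = (edges I \<X>)\<^sup>* `` {a}"
    using K unfolding components_def by (auto elim!: quotientE)
  have aux: False
    if ST: "T \<noteq> {}" "S \<inter> T = {}" "S \<union> T = K" "a \<in> S"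
      and z: "\<And>i j. i \<in> S \<Longrightarrow> j \<in> T \<Longrightarrow> Q_mat \<X> i j = 0" for S T
  proof -
    have "x \<in> S" if "(a, x) \<in> (edges I \<X>)\<^sup>*" for x
      using that
    proof (induction rule: rtrancl_induct)
      case base
      show ?case by fact
    next
      case (step y w)
      have "w \<in> K" using step.hyps a by (auto intro: rtrancl_into_rtrancl)
      moreover have "Q_mat \<X> y w \<noteq> 0"
        using Q_mat_offdiag[OF assms(1-3), of y w] step.hyps(2) by (auto simp: edges_def)
      ultimately show ?case using z[OF step.IH] ST(3) by auto
    qed
    then show False using ST a by auto
  qed
  have aK: "a \<in> K" using a by auto
  show ?thesis
    unfolding indecomposable_def
  proof (intro conjI notI)
    show "K = {} \<Longrightarrow> False" using aK by simp
    assume "\<exists>S T. S \<noteq> {} \<and> T \<noteq> {} \<and> S \<inter> T = {} \<and> S \<union> T = K \<and>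
           (\<forall>i\<in>S. \<forall>j\<in>T. Q_mat \<X> i j = 0 \<and> Q_mat \<X> j i = 0)"
    then obtain S T where ST: "S \<noteq> {}" "T \<noteq> {}" "S \<inter> T = {}" "S \<union> T = K"
      and z: "\<And>i j. i \<in> S \<Longrightarrow> j \<in> T \<Longrightarrow> Q_mat \<X> i j = 0 \<and> Q_mat \<X> j i = 0" by blast
    show False
    proof (cases "a \<in> S")
      case True
      show False by (rule aux[of T S]) (use ST z True in simp_all)
    next
      case False
      then have "a \<in> T" using ST aK by blast
      show False by (rule aux[of S T]) (use ST z \<open>a \<in> T\<close> in \<open>auto simp: Int_commute\<close>)
    qed
  qed
qed

end

theory Submission
  imports "HOL-Analysis.Function_Topology" Defs
begin

text \<open>
  Since \<open>Q = J\<^sup>tJ - E\<close>, the quadratic form of \<open>Q\<close> at \<open>v\<close> is \<open>\<bar>Jv\<bar>\<^sup>2 - (\<Sum>v)\<^sup>2\<close>. It is therefore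
  nonnegative on the hyperplane of vectors with coordinate sum zero
  (\<open>quad_form_Q_mat_nonneg_on_hyperplane\<close>), so it cannot take a negative value on one
  component and a nonpositive value at a nonzero vector on another: because off-diagonal entries are nonpositive, passing to absolute
  values does not increase the form, so the vector on the second component may be taken nonnegative;
  its coordinate sum is then positive, a combination of the two vectors lies in the hyperplane, and
  on it the form would be negative (\<open>quad_form_pos_on_other_block\<close>). Hence an indefinite component
  forces all the others to be finite.

  It remains to see that each component has one of the three types (\<open>vinberg_trichotomy\<close>). The
  minimum \<open>c\<close> of the form on the unit sphere is an eigenvalue. A minimiser may be replaced by its
  absolute values, and indecomposability then makes all its coordinates positive, as in the
  Perron-Frobenius theorem (\<open>isotropic_full_support\<close>). The matrix is finite, affine or indefinite
  according as \<open>c\<close> is positive, zero or negative.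
\<close>

section \<open>Quadratic forms on vectors indexed by a finite set\<close>

lemma mat_vec_in_vecs: "mat_vec K A v \<in> vecs K"
  by (simp add: vecs_def mat_vec_def)

lemma quad_form_double_sum:
  "quad_form K A v = (\<Sum>i\<in>K. \<Sum>j\<in>K. A i j * v i * v j)"
  unfolding quad_form_def mat_vec_def
  by (intro sum.cong) (auto simp: sum_distrib_left mult_ac)

lemma quad_form_shift_diagonal:
  "quad_form K (\<lambda>i j. A i j - (if i = j then c else 0)) v = quad_form K A v - c * (\<Sum>i\<in>K. (v i)\<^sup>2)"
  if "finite K"
proof -
  have "(\<Sum>i\<in>K. \<Sum>j\<in>K. (if i = j then c else 0) * v i * v j) = (\<Sum>i\<in>K. c * (v i)\<^sup>2)"
  proof (intro sum.cong refl)
    fix i assume "i \<in> K"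
    have "(\<Sum>j\<in>K. (if i = j then c else 0) * v i * v j) = (\<Sum>j\<in>K. if i = j then c * v i * v j else 0)"
      by (intro sum.cong) auto
    also have "\<dots> = c * (v i)\<^sup>2"
      using that \<open>i \<in> K\<close> by (simp add: power2_eq_square)
    finally show "(\<Sum>j\<in>K. (if i = j then c else 0) * v i * v j) = c * (v i)\<^sup>2" .
  qed
  then show ?thesis
    by (simp add: quad_form_double_sum left_diff_distrib sum_subtractf sum_distrib_left)
qed

lemma mat_vec_self_adjoint:
  assumes "\<And>i j. i \<in> K \<Longrightarrow> j \<in> K \<Longrightarrow> A i j = A j i"
  shows "(\<Sum>i\<in>K. v i * mat_vec K A w i) = (\<Sum>i\<in>K. w i * mat_vec K A v i)"
proof -
  have "(\<Sum>i\<in>K. v i * mat_vec K A w i) = (\<Sum>i\<in>K. \<Sum>j\<in>K. v i * A i j * w j)"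
    unfolding mat_vec_def by (intro sum.cong) (auto simp: sum_distrib_left mult_ac)
  also have "\<dots> = (\<Sum>j\<in>K. \<Sum>i\<in>K. v i * A i j * w j)"
    by (rule sum.swap)
  also have "\<dots> = (\<Sum>j\<in>K. w j * mat_vec K A v j)"
    unfolding mat_vec_def using assms by (intro sum.cong) (auto simp: sum_distrib_left mult_ac)
  finally show ?thesis .
qed

lemma mat_vec_add_scaled:
  "mat_vec K A (\<lambda>i. v i + t * w i) = (\<lambda>i. mat_vec K A v i + t * mat_vec K A w i)"
  by (auto simp: mat_vec_def fun_eq_iff distrib_left sum.distrib sum_distrib_left mult_ac)

lemma quad_form_add_scaled:
  assumes "\<And>i j. i \<in> K \<Longrightarrow> j \<in> K \<Longrightarrow> A i j = A j i"
  shows "quad_form K A (\<lambda>i. v i + t * w i) =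
    quad_form K A v + 2 * t * (\<Sum>i\<in>K. w i * mat_vec K A v i) + t\<^sup>2 * quad_form K A w"
proof -
  have "quad_form K A (\<lambda>i. v i + t * w i) =
      (\<Sum>i\<in>K. v i * mat_vec K A v i) + t * (\<Sum>i\<in>K. v i * mat_vec K A w i)
      + t * (\<Sum>i\<in>K. w i * mat_vec K A v i) + t\<^sup>2 * (\<Sum>i\<in>K. w i * mat_vec K A w i)"
    unfolding quad_form_def mat_vec_add_scaled
    by (simp add: algebra_simps sum.distrib sum_distrib_left power2_eq_square)
  then show ?thesis
    using mat_vec_self_adjoint[OF assms, where v = v and w = w] by (simp add: quad_form_def)
qed

text \<open>
  An isotropic vector of a positive semidefinite form minimises it, so the first-order term of the
  form at this vector vanishes.
\<close>

lemma pos_semidef_isotropic_in_kernel: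
  assumes fin: "finite K" and sym: "\<And>i j. i \<in> K \<Longrightarrow> j \<in> K \<Longrightarrow> A i j = A j i"
    and psd: "pos_semidef K A" and v: "v \<in> vecs K" "quad_form K A v = 0"
  shows "mat_vec K A v = 0"
proof -
  define w where "w = mat_vec K A v"
  define s where "s = (\<Sum>i\<in>K. w i * mat_vec K A v i)"
  define c where "c = quad_form K A w"
  have wK: "w \<in> vecs K" by (simp add: w_def mat_vec_in_vecs)
  have c: "c \<ge> 0" using psd wK by (auto simp: pos_semidef_def c_def)
  have s: "s = (\<Sum>i\<in>K. (w i)\<^sup>2)" by (simp add: s_def w_def power2_eq_square)
  have ge: "0 \<le> 2 * t * s + t\<^sup>2 * c" for t
  proof -
    have "(\<lambda>i. v i + t * w i) \<in> vecs K" using v wK by (simp add: vecs_def)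
    then have "0 \<le> quad_form K A (\<lambda>i. v i + t * w i)" using psd by (simp add: pos_semidef_def)
    then show ?thesis
      using quad_form_add_scaled[OF sym, where v = v and t = t and w = w] v by (simp add: s_def c_def)
  qed
  have "s = 0"
  proof (rule ccontr)
    assume "s \<noteq> 0"
    \<comment> \<open>A step against the gradient, short enough for the linear term to dominate.\<close>
    define t where "t = s / (c + 1)"
    have st: "s = t * (c + 1)" and "t \<noteq> 0" using c \<open>s \<noteq> 0\<close> by (auto simp: t_def)
    have "2 * (- t) * s + (- t)\<^sup>2 * c = - (t\<^sup>2 * (c + 2))"
      unfolding st by (simp add: algebra_simps power2_eq_square)
    also have "\<dots> < 0" using c \<open>t \<noteq> 0\<close> by simp
    finally show False using ge[of "- t"] by simp
  qed
  then have "\<forall>i\<in>K. w i = 0" using fin s by (simp add: sum_nonneg_eq_0_iff)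
  then show ?thesis using wK by (auto simp: w_def vecs_def fun_eq_iff)
qed

section \<open>Perron-Frobenius theory for matrices with nonpositive off-diagonal entries\<close>

lemma quad_form_abs_le:
  assumes "\<And>i j. i \<in> K \<Longrightarrow> j \<in> K \<Longrightarrow> i \<noteq> j \<Longrightarrow> A i j \<le> 0"
  shows "quad_form K A (\<lambda>i. \<bar>v i\<bar>) \<le> quad_form K A v"
  unfolding quad_form_double_sum
proof (intro sum_mono)
  fix i j assume ij: "i \<in> K" "j \<in> K"
  show "A i j * \<bar>v i\<bar> * \<bar>v j\<bar> \<le> A i j * v i * v j"
  proof (cases "i = j")
    case False
    have "v i * v j \<le> \<bar>v i\<bar> * \<bar>v j\<bar>" by (simp flip: abs_mult)
    then have "A i j * (\<bar>v i\<bar> * \<bar>v j\<bar>) \<le> A i j * (v i * v j)"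
      using assms[OF ij False] by (rule mult_left_mono_neg)
    then show ?thesis by (simp add: mult.assoc)
  qed (simp add: mult.assoc)
qed

text \<open>
  The vector of absolute values is again isotropic, hence lies in the kernel. At an index where it
  vanishes, the kernel equation is a sum of nonpositive terms, so all matrix entries linking this
  index to the support are zero; indecomposability then forces the support to be everything.
\<close>

lemma isotropic_full_support:
  assumes fin: "finite K" and sym: "\<And>i j. i \<in> K \<Longrightarrow> j \<in> K \<Longrightarrow> A i j = A j i"
    and off: "\<And>i j. i \<in> K \<Longrightarrow> j \<in> K \<Longrightarrow> i \<noteq> j \<Longrightarrow> A i j \<le> 0"
    and ind: "indecomposable K A" and psd: "pos_semidef K A"
    and v: "v \<in> vecs K" "v \<noteq> 0" "quad_form K A v = 0"
  shows "mat_vec K A (\<lambda>i. \<bar>v i\<bar>) = 0" and "\<forall>i\<in>K. v i \<noteq> 0"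
proof -
  have aK: "(\<lambda>i. \<bar>v i\<bar>) \<in> vecs K" using v by (simp add: vecs_def)
  have "quad_form K A (\<lambda>i. \<bar>v i\<bar>) = 0"
  proof (rule antisym)
    show "quad_form K A (\<lambda>i. \<bar>v i\<bar>) \<le> 0"
      using quad_form_abs_le[of K A v] off v by simp
    show "0 \<le> quad_form K A (\<lambda>i. \<bar>v i\<bar>)"
      using psd aK by (simp add: pos_semidef_def)
  qed
  then show ker: "mat_vec K A (\<lambda>i. \<bar>v i\<bar>) = 0"
    using pos_semidef_isotropic_in_kernel[OF fin sym psd aK] by simp
  define S T where "S = {i \<in> K. v i \<noteq> 0}" and "T = {i \<in> K. v i = 0}"
  have zero: "A i j = 0" if "i \<in> T" "j \<in> S" for i j
  proof -
    have iK: "i \<in> K" using that by (simp add: T_def)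
    have "(\<Sum>j\<in>K. A i j * \<bar>v j\<bar>) = 0"
      using fun_cong[OF ker, of i] iK by (simp add: mat_vec_def)
    then have "(\<Sum>j\<in>K. - (A i j * \<bar>v j\<bar>)) = 0" by (simp add: sum_negf)
    moreover have "0 \<le> - (A i j * \<bar>v j\<bar>)" if "j \<in> K" for j
    proof (cases "i = j")
      case True
      then show ?thesis using \<open>i \<in> T\<close> by (simp add: T_def)
    next
      case False
      then show ?thesis using off[OF iK that] by (simp add: mult_nonpos_nonneg)
    qed
    ultimately have "\<forall>j\<in>K. - (A i j * \<bar>v j\<bar>) = 0"
      using fin by (subst (asm) sum_nonneg_eq_0_iff) auto
    then show ?thesis using \<open>j \<in> S\<close> by (auto simp: S_def)
  qed
  have "S \<noteq> {}" using v by (auto simp: S_def vecs_def fun_eq_iff)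
  moreover have "S \<inter> T = {}" "S \<union> T = K" by (auto simp: S_def T_def)
  moreover have "\<forall>i\<in>S. \<forall>j\<in>T. A i j = 0 \<and> A j i = 0"
    using zero sym \<open>S \<union> T = K\<close> by (metis UnI1 UnI2)
  ultimately have "T = {}" using ind unfolding indecomposable_def by blast
  then show "\<forall>i\<in>K. v i \<noteq> 0" by (auto simp: T_def)
qed

text \<open>
  The form attains its minimum \<open>c\<close> on the unit sphere because the sphere is a closed subset of a
  product of compact intervals; homogeneity extends the bound to all vectors.
\<close>

lemma quad_form_min_on_sphere:
  assumes fin: "finite K" and ne: "K \<noteq> {}"
  obtains c v where "v \<in> vecs K" "v \<noteq> 0" "quad_form K A v = c * (\<Sum>i\<in>K. (v i)\<^sup>2)"
    "\<And>w. w \<in> vecs K \<Longrightarrow> c * (\<Sum>i\<in>K. (w i)\<^sup>2) \<le> quad_form K A w"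
proof -
  define B :: "('a \<Rightarrow> real) set" where "B = PiE UNIV (\<lambda>i. if i \<in> K then {-1..1} else {0})"
  define N where "N = (\<lambda>v::'a \<Rightarrow> real. \<Sum>i\<in>K. (v i)\<^sup>2)"
  define S where "S = B \<inter> {v. N v = 1}"
  have "compactin euclidean B"
    unfolding B_def euclidean_product_topology[symmetric]
    by (subst compactin_PiE) auto
  then have "compact B" by simp
  have coord: "continuous_on X (\<lambda>v::'a \<Rightarrow> real. v i)" for X i
    by (rule continuous_on_subset[OF continuous_on_product_coordinates]) simp
  have "continuous_on UNIV N" unfolding N_def by (intro continuous_intros coord)
  then have "closed {v. N v = 1}" by (intro closed_Collect_eq) auto
  then have "compact S" unfolding S_def using \<open>compact B\<close> by (rule compact_Int_closed[rotated])
  have inS: "v \<in> S" if v: "v \<in> vecs K" "N v = 1" for v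
  proof -
    have "\<bar>v i\<bar> \<le> 1" if "i \<in> K" for i
    proof -
      have "(v i)\<^sup>2 \<le> N v" unfolding N_def using fin that by (intro member_le_sum) auto
      then show ?thesis using v abs_le_square_iff[of "v i" 1] by simp
    qed
    then show ?thesis using v by (auto simp: S_def B_def vecs_def abs_le_iff minus_le_iff)
  qed
  obtain k where k: "k \<in> K" using ne by blast
  define e where "e = (\<lambda>i. if i = k then 1 else 0 :: real)"
  have "N e = (\<Sum>i\<in>K. if i = k then 1 else 0)" unfolding N_def e_def by (intro sum.cong) auto
  then have "e \<in> S" using k fin by (intro inS) (auto simp: vecs_def e_def)
  have "continuous_on S (quad_form K A)"
    unfolding quad_form_double_sum[abs_def] by (intro continuous_intros coord)
  then obtain v where v: "v \<in> S" "\<forall>w\<in>S. quad_form K A v \<le> quad_form K A w"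
    using continuous_attains_inf[OF \<open>compact S\<close>] \<open>e \<in> S\<close> by blast
  show ?thesis
  proof
    show "v \<in> vecs K" using v by (auto simp: S_def B_def vecs_def PiE_iff split: if_splits)
    show "v \<noteq> 0" using v by (auto simp: S_def N_def)
    show "quad_form K A v = quad_form K A v * (\<Sum>i\<in>K. (v i)\<^sup>2)"
      using v by (simp add: S_def N_def)
    fix w assume w: "w \<in> vecs K"
    show "quad_form K A v * (\<Sum>i\<in>K. (w i)\<^sup>2) \<le> quad_form K A w"
    proof (cases "N w = 0")
      case True
      then have "\<forall>i\<in>K. w i = 0" using fin by (simp add: N_def sum_nonneg_eq_0_iff)
      then show ?thesis by (simp add: quad_form_def)
    next
      case False
      then have pos: "N w > 0" by (simp add: N_def sum_nonneg order_less_le)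
      define r where "r = 1 / sqrt (N w)"
      have r2: "r * r = 1 / N w" using pos by (simp add: r_def)
      have "N (\<lambda>i. r * w i) = r * r * N w"
        by (simp add: N_def power2_eq_square sum_distrib_left mult_ac)
      then have "(\<lambda>i. r * w i) \<in> S" using w pos r2 by (intro inS) (auto simp: vecs_def)
      then have "quad_form K A v \<le> quad_form K A (\<lambda>i. r * w i)" using v by blast
      also have "\<dots> = r * r * quad_form K A w"
        by (simp add: quad_form_double_sum sum_distrib_left mult_ac)
      finally have "quad_form K A v \<le> quad_form K A w / N w" by (simp add: r2)
      then show ?thesis using pos by (simp add: N_def field_simps)
    qed
  qed
qed

section \<open>The three types of indecomposable matrices\<close>

lemma sum_columns_eq_mat_vec:
  "(\<Sum>j\<in>K. fun_scale (c j) (mat_column K A j)) = mat_vec K A c"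
proof
  fix i
  have "(\<Sum>j\<in>L. fun_scale (c j) (mat_column K A j)) i = (\<Sum>j\<in>L. c j * mat_column K A j i)" for L
    by (induction L rule: infinite_finite_induct) (auto simp: fun_scale_def)
  then show "(\<Sum>j\<in>K. fun_scale (c j) (mat_column K A j)) i = mat_vec K A c i"
    by (auto simp: mat_vec_def mat_column_def mult.commute)
qed

text \<open>
  The kernel relation expresses one column through the others, and the remaining columns are
  independent because a relation among them would be a kernel vector with a zero coordinate.
\<close>

lemma mat_rank_kernel_line:
  assumes fin: "finite K" and ne: "K \<noteq> {}" and u: "\<forall>i\<in>K. u i \<noteq> 0"
    and ns: "null_space K A = fun_space.span {u}"
  shows "mat_rank K A + 1 = card K"
proof -
  let ?C = "mat_column K A"
  obtain k where k: "k \<in> K" using ne by blast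
  define D where "D = K - {k}"
  have KD: "K = insert k D" "k \<notin> D" "finite D" using k fin by (auto simp: D_def)
  have uker: "mat_vec K A u = 0"
  proof -
    have "u \<in> null_space K A" unfolding ns by (simp add: fun_space.span_base)
    then show ?thesis by (simp add: null_space_def)
  qed
  have rel: "\<forall>i\<in>D. c i = 0" if "(\<Sum>j\<in>D. fun_scale (c j) (?C j)) = 0" for c
  proof -
    define c' where "c' = (\<lambda>i. if i \<in> D then c i else 0)"
    have "(\<Sum>j\<in>D. fun_scale (c' j) (?C j)) = (\<Sum>j\<in>D. fun_scale (c j) (?C j))"
      by (intro sum.cong) (auto simp: c'_def)
    then have "(\<Sum>j\<in>D. fun_scale (c' j) (?C j)) = 0" using that by simp
    moreover have "fun_scale (c' k) (?C k) = 0"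
      using KD by (simp add: c'_def)
    ultimately have "(\<Sum>j\<in>K. fun_scale (c' j) (?C j)) = 0"
      using KD by simp
    then have "c' \<in> null_space K A"
      using KD by (auto simp: sum_columns_eq_mat_vec null_space_def vecs_def c'_def)
    then obtain a where a: "c' = fun_scale a u"
      unfolding ns fun_space.span_singleton by auto
    have "a * u k = 0" using fun_cong[OF a, of k] KD by (simp add: fun_scale_def c'_def)
    then have "c' = 0" using u k a by simp
    then show ?thesis by (metis c'_def zero_fun_def)
  qed
  have inj: "inj_on ?C D"
  proof (rule inj_onI, rule ccontr)
    fix i j assume ij: "i \<in> D" "j \<in> D" "?C i = ?C j" "i \<noteq> j"
    define c where "c = (\<lambda>l. if l = i then 1 else if l = j then -1 else 0 :: real)"
    have "(\<Sum>l\<in>D. fun_scale (c l) (?C l)) = (\<Sum>l\<in>{i, j}. fun_scale (c l) (?C l))"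
      using ij KD by (intro sum.mono_neutral_right) (auto simp: c_def)
    also have "\<dots> = 0" using ij by (simp add: c_def)
    finally have "\<forall>l\<in>D. c l = 0" by (rule rel)
    then show False using ij(1) by (auto simp: c_def)
  qed
  have indep: "\<not> fun_space.dependent (?C ` D)"
  proof (rule fun_space.independent_if_scalars_zero)
    show "finite (?C ` D)" using KD by simp
    fix f x assume f: "(\<Sum>x\<in>?C ` D. fun_scale (f x) x) = 0" and x: "x \<in> ?C ` D"
    have "(\<Sum>j\<in>D. fun_scale (f (?C j)) (?C j)) = 0"
      using f by (simp add: sum.reindex[OF inj])
    then show "f x = 0" using rel[of "\<lambda>j. f (?C j)"] x by blast
  qed
  have "fun_scale (u k) (?C k) + (\<Sum>j\<in>D. fun_scale (u j) (?C j)) = 0"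
    using uker KD by (simp flip: sum_columns_eq_mat_vec)
  then have "fun_scale (u k) (?C k) = - (\<Sum>j\<in>D. fun_scale (u j) (?C j))"
    by (rule eq_neg_iff_add_eq_0[THEN iffD2])
  moreover have "- (\<Sum>j\<in>D. fun_scale (u j) (?C j)) \<in> fun_space.span (?C ` D)"
    by (intro fun_space.span_neg fun_space.span_sum fun_space.span_scale fun_space.span_base) auto
  ultimately have "fun_scale (u k) (?C k) \<in> fun_space.span (?C ` D)" by simp
  then have "fun_scale (1 / u k) (fun_scale (u k) (?C k)) \<in> fun_space.span (?C ` D)"
    by (rule fun_space.span_scale)
  then have "?C k \<in> fun_space.span (?C ` D)" using u k by simp
  then have "fun_space.span (?C ` K) = fun_space.span (?C ` D)"
    using KD by (simp add: fun_space.span_redundant)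
  then have "mat_rank K A = card (?C ` D)"
    unfolding mat_rank_def using indep by (intro fun_space.dim_eq_card) simp_all
  then show ?thesis using KD inj by (simp add: card_image)
qed

text \<open>
  The absolute values of the isotropic vector form a positive kernel vector. A kernel vector not
  proportional to it would yield a nonzero combination with a zero coordinate, contradicting full
  support; so the kernel is a line, and this determines the rank.
\<close>

lemma affine_type_if_isotropic:
  assumes fin: "finite K" and sym: "\<And>i j. i \<in> K \<Longrightarrow> j \<in> K \<Longrightarrow> A i j = A j i"
    and off: "\<And>i j. i \<in> K \<Longrightarrow> j \<in> K \<Longrightarrow> i \<noteq> j \<Longrightarrow> A i j \<le> 0"
    and ind: "indecomposable K A" and psd: "pos_semidef K A"
    and v: "v \<in> vecs K" "v \<noteq> 0" "quad_form K A v = 0"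
  shows "affine_type K A"
proof -
  define u where "u = (\<lambda>i. \<bar>v i\<bar>)"
  have uK: "u \<in> vecs K" using v by (simp add: u_def vecs_def)
  have uker: "mat_vec K A u = 0" and upos: "\<forall>i\<in>K. u i > 0"
    using isotropic_full_support[OF fin sym off ind psd v] by (auto simp: u_def)
  have ne: "K \<noteq> {}" using ind by (simp add: indecomposable_def)
  then obtain k where k: "k \<in> K" by blast
  have "null_space K A = fun_space.span {u}"
  proof (intro equalityI subsetI)
    fix w assume "w \<in> null_space K A"
    then have w: "w \<in> vecs K" "mat_vec K A w = 0" by (auto simp: null_space_def)
    define a where "a = w k / u k"
    define z where "z = (\<lambda>i. w i + (- a) * u i)"
    have zK: "z \<in> vecs K" using w uK by (simp add: z_def vecs_def)
    have "mat_vec K A z = 0"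
      unfolding z_def mat_vec_add_scaled w uker by (simp add: fun_eq_iff)
    then have "quad_form K A z = 0" by (simp add: quad_form_def)
    moreover have "z k = 0" using upos k by (auto simp: z_def a_def)
    ultimately have "z = 0"
      using isotropic_full_support(2)[OF fin sym off ind psd zK] k by blast
    then have "w = fun_scale a u" by (auto simp: z_def fun_scale_def fun_eq_iff)
    then show "w \<in> fun_space.span {u}" by (auto simp: fun_space.span_singleton)
  next
    fix w assume "w \<in> fun_space.span {u}"
    then obtain a where w: "w = fun_scale a u" by (auto simp: fun_space.span_singleton)
    have "mat_vec K A w = (\<lambda>i. a * mat_vec K A u i)"
      using mat_vec_add_scaled[of K A "\<lambda>_. 0" a u] by (simp add: w fun_scale_def mat_vec_def fun_eq_iff)
    then show "w \<in> null_space K A"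
      using uK uker by (simp add: null_space_def w vecs_def fun_scale_def fun_eq_iff)
  qed
  moreover from this have "mat_rank K A + 1 = card K"
    using upos by (intro mat_rank_kernel_line[OF fin ne]) auto
  ultimately show ?thesis
    unfolding affine_type_def using psd uK upos by blast
qed

text \<open>
  Subtracting the minimum \<open>c\<close> of the form on the unit sphere from the diagonal gives a
  positive semidefinite matrix with an isotropic vector, hence a positive
  eigenvector of \<open>A\<close> for the eigenvalue \<open>c\<close>. The sign of \<open>c\<close> decides the type.
\<close>

lemma vinberg_trichotomy:
  assumes fin: "finite K" and sym: "\<And>i j. i \<in> K \<Longrightarrow> j \<in> K \<Longrightarrow> A i j = A j i"
    and off: "\<And>i j. i \<in> K \<Longrightarrow> j \<in> K \<Longrightarrow> i \<noteq> j \<Longrightarrow> A i j \<le> 0"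
    and ind: "indecomposable K A"
  shows "finite_type K A \<or> affine_type K A \<or> indefinite_type K A"
proof -
  have ne: "K \<noteq> {}" using ind by (simp add: indecomposable_def)
  obtain c v where v: "v \<in> vecs K" "v \<noteq> 0" "quad_form K A v = c * (\<Sum>i\<in>K. (v i)\<^sup>2)"
    and min: "\<And>w. w \<in> vecs K \<Longrightarrow> c * (\<Sum>i\<in>K. (w i)\<^sup>2) \<le> quad_form K A w"
    using quad_form_min_on_sphere[OF fin ne, where A = A] by blast
  consider "c > 0" | "c = 0" | "c < 0" by linarith
  then show ?thesis
  proof cases
    case 1
    have "quad_form K A w > 0" if w: "w \<in> vecs K" "w \<noteq> 0" for w
    proof -
      obtain k where k: "k \<in> K" "w k \<noteq> 0" using w by (auto simp: vecs_def fun_eq_iff)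
      have "(\<Sum>i\<in>K. (w i)\<^sup>2) > 0" using fin k by (intro sum_pos2[of _ k]) auto
      then have "0 < c * (\<Sum>i\<in>K. (w i)\<^sup>2)" using 1 by simp
      then show ?thesis using min[OF w(1)] by linarith
    qed
    then show ?thesis by (simp add: finite_type_def pos_def_def)
  next
    case 2
    then have "pos_semidef K A" using min by (simp add: pos_semidef_def)
    then show ?thesis
      using affine_type_if_isotropic[OF fin sym off ind _ v(1,2)] v(3) 2 by simp
  next
    case 3
    define B where "B = (\<lambda>i j. A i j - (if i = j then c else 0))"
    have symB: "\<And>i j. i \<in> K \<Longrightarrow> j \<in> K \<Longrightarrow> B i j = B j i" using sym by (auto simp: B_def)
    have offB: "\<And>i j. i \<in> K \<Longrightarrow> j \<in> K \<Longrightarrow> i \<noteq> j \<Longrightarrow> B i j \<le> 0"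
      using off by (auto simp: B_def)
    have indB: "indecomposable K B"
      unfolding indecomposable_def
    proof (intro conjI notI)
      assume "\<exists>S T. S \<noteq> {} \<and> T \<noteq> {} \<and> S \<inter> T = {} \<and> S \<union> T = K \<and>
        (\<forall>i\<in>S. \<forall>j\<in>T. B i j = 0 \<and> B j i = 0)"
      then obtain S T where ST: "S \<noteq> {}" "T \<noteq> {}" "S \<inter> T = {}" "S \<union> T = K"
        "\<And>i j. i \<in> S \<Longrightarrow> j \<in> T \<Longrightarrow> B i j = 0 \<and> B j i = 0" by blast
      have "A i j = 0 \<and> A j i = 0" if "i \<in> S" "j \<in> T" for i j
        using ST(5)[OF that] ST(3) that by (auto simp: B_def split: if_splits)
      then show False using ind ST(1-4) unfolding indecomposable_def by blast
    qed (use ne in simp)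
    have qB: "quad_form K B w = quad_form K A w - c * (\<Sum>i\<in>K. (w i)\<^sup>2)" for w
      unfolding B_def by (rule quad_form_shift_diagonal[OF fin])
    have psdB: "pos_semidef K B" using min by (simp add: pos_semidef_def qB)
    have "quad_form K B v = 0" using v by (simp add: qB)
    note full = isotropic_full_support[OF fin symB offB indB psdB v(1,2) this]
    define u where "u = (\<lambda>i. \<bar>v i\<bar>)"
    have "mat_vec K A u i < 0" if i: "i \<in> K" for i
    proof -
      have "(\<Sum>j\<in>K. B i j * u j) = 0"
        using fun_cong[OF full(1), of i] i by (simp add: mat_vec_def u_def)
      moreover have "(\<Sum>j\<in>K. B i j * u j) = (\<Sum>j\<in>K. A i j * u j - (if i = j then c * u j else 0))"
        by (intro sum.cong) (auto simp: B_def left_diff_distrib)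
      ultimately have "mat_vec K A u i = c * u i"
        using i fin by (simp add: mat_vec_def sum_subtractf)
      then show ?thesis using full(2) i 3 by (simp add: u_def mult_neg_pos)
    qed
    then have "indefinite_type K A"
      unfolding indefinite_type_def using v full(2) by (intro bexI[of _ u]) (auto simp: u_def vecs_def)
    then show ?thesis by simp
  qed
qed

lemma indefinite_type_negative_vector:
  assumes "finite K" "K \<noteq> {}" "indefinite_type K A"
  obtains u where "u \<in> vecs K" "u \<noteq> 0" "quad_form K A u < 0"
proof -
  obtain u where u: "u \<in> vecs K" "\<forall>i\<in>K. u i > 0" "\<forall>i\<in>K. mat_vec K A u i < 0"
    using assms(3) by (auto simp: indefinite_type_def)
  have "(\<Sum>i\<in>K. - (u i * mat_vec K A u i)) > 0"
    using assms u by (intro sum_pos) (auto simp: mult_pos_neg)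
  then have "quad_form K A u < 0" by (simp add: quad_form_def sum_negf)
  moreover have "u \<noteq> 0" using u assms(2) by auto
  ultimately show ?thesis using that u by blast
qed

section \<open>The form of \<open>J\<^sup>tJ - E\<close> on two blocks\<close>

lemma quad_form_Q_mat:
  "quad_form M (Q_mat \<X>) v =
    (\<Sum>X\<in>\<X>. (\<Sum>i\<in>M. of_int (incidence X i) * v i)\<^sup>2) - (\<Sum>i\<in>M. v i)\<^sup>2"
proof -
  have "(\<Sum>i\<in>M. \<Sum>j\<in>M. (\<Sum>X\<in>\<X>. of_int (incidence X i) * of_int (incidence X j)) * v i * v j)
      = (\<Sum>i\<in>M. \<Sum>j\<in>M. \<Sum>X\<in>\<X>. (of_int (incidence X i) * v i) * (of_int (incidence X j) * v j))"
    by (simp add: sum_distrib_left sum_distrib_right mult_ac)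
  also have "\<dots> = (\<Sum>i\<in>M. \<Sum>X\<in>\<X>. \<Sum>j\<in>M. (of_int (incidence X i) * v i) * (of_int (incidence X j) * v j))"
    by (intro sum.cong refl sum.swap)
  also have "\<dots> = (\<Sum>X\<in>\<X>. \<Sum>i\<in>M. \<Sum>j\<in>M. (of_int (incidence X i) * v i) * (of_int (incidence X j) * v j))"
    by (rule sum.swap)
  also have "\<dots> = (\<Sum>X\<in>\<X>. (\<Sum>i\<in>M. of_int (incidence X i) * v i)\<^sup>2)"
    by (simp add: power2_eq_square sum_product)
  finally show ?thesis
    unfolding quad_form_double_sum Q_mat_def Q_int_def
    by (simp add: left_diff_distrib sum_subtractf power2_eq_square sum_product)
qed

lemma quad_form_Q_mat_nonneg_on_hyperplane:
  "(\<Sum>i\<in>M. v i) = 0 \<Longrightarrow> quad_form M (Q_mat \<X>) v \<ge> 0"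
  by (simp add: quad_form_Q_mat sum_nonneg)

lemma quad_form_block_sum:
  assumes "finite K" "finite L" "K \<inter> L = {}"
    and "\<And>i j. i \<in> K \<Longrightarrow> j \<in> L \<Longrightarrow> A i j = 0 \<and> A j i = 0"
    and "v \<in> vecs K" "w \<in> vecs L"
  shows "quad_form (K \<union> L) A (\<lambda>i. a * v i + b * w i) = a\<^sup>2 * quad_form K A v + b\<^sup>2 * quad_form L A w"
proof -
  have vw: "w i = 0" if "i \<in> K" for i using assms(3,6) that by (auto simp: vecs_def)
  have wv: "v i = 0" if "i \<in> L" for i using assms(3,5) that by (auto simp: vecs_def)
  show ?thesis
    unfolding quad_form_double_sum
    using assms(1-4)
    by (simp add: sum.union_disjoint vw wv sum_distrib_left power2_eq_square mult_ac)
qed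

text \<open>
  Were the form nonpositive at \<open>v\<close>, it would be nonpositive at the vector \<open>w\<close> of absolute values,
  whose coordinate sum is positive. The combination of \<open>u\<close> and \<open>w\<close> with coordinate sum zero then
  has a nonzero coefficient at \<open>u\<close>, and by block orthogonality the form is negative there, against
  its nonnegativity on the hyperplane.
\<close>

lemma quad_form_pos_on_other_block:
  assumes fin: "finite K" "finite L" and disj: "K \<inter> L = {}"
    and block: "\<And>i j. i \<in> K \<Longrightarrow> j \<in> L \<Longrightarrow> Q_mat \<X> i j = 0"
    and off: "\<And>i j. i \<in> L \<Longrightarrow> j \<in> L \<Longrightarrow> i \<noteq> j \<Longrightarrow> Q_mat \<X> i j \<le> 0"
    and u: "u \<in> vecs K" "quad_form K (Q_mat \<X>) u < 0"
    and v: "v \<in> vecs L" "v \<noteq> 0"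
  shows "quad_form L (Q_mat \<X>) v > 0"
proof (rule ccontr)
  assume nonpos: "\<not> quad_form L (Q_mat \<X>) v > 0"
  define w where "w = (\<lambda>i. \<bar>v i\<bar>)"
  have wL: "w \<in> vecs L" using v by (simp add: w_def vecs_def)
  have qw: "quad_form L (Q_mat \<X>) w \<le> 0"
    using quad_form_abs_le[of L "Q_mat \<X>" v] off nonpos by (simp add: w_def)
  obtain k where k: "k \<in> L" "v k \<noteq> 0" using v by (auto simp: vecs_def fun_eq_iff)
  have sw: "(\<Sum>i\<in>L. w i) > 0" using fin k by (intro sum_pos2[of _ k]) (auto simp: w_def)
  let ?a = "\<Sum>i\<in>L. w i" and ?b = "- (\<Sum>i\<in>K. u i)"
  have "(\<Sum>i\<in>K \<union> L. ?a * u i + ?b * w i) = (\<Sum>i\<in>K. ?a * u i) + (\<Sum>i\<in>L. ?b * w i)"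
  proof -
    have "(\<Sum>i\<in>K. ?a * u i + ?b * w i) = (\<Sum>i\<in>K. ?a * u i)"
      using wL disj by (intro sum.cong) (auto simp: vecs_def)
    moreover have "(\<Sum>i\<in>L. ?a * u i + ?b * w i) = (\<Sum>i\<in>L. ?b * w i)"
      using u disj by (intro sum.cong) (auto simp: vecs_def)
    ultimately show ?thesis using fin disj by (simp only: sum.union_disjoint)
  qed
  also have "\<dots> = 0" by (simp only: sum_distrib_left[symmetric]) simp
  finally have "0 \<le> quad_form (K \<union> L) (Q_mat \<X>) (\<lambda>i. ?a * u i + ?b * w i)"
    by (rule quad_form_Q_mat_nonneg_on_hyperplane)
  also have "\<dots> = ?a\<^sup>2 * quad_form K (Q_mat \<X>) u + ?b\<^sup>2 * quad_form L (Q_mat \<X>) w"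
    using block Q_mat_sym[of \<X>] by (intro quad_form_block_sum fin disj u wL) metis
  also have "\<dots> < 0"
  proof -
    have "?a\<^sup>2 * quad_form K (Q_mat \<X>) u < 0" using sw u by (intro mult_pos_neg) auto
    moreover have "?b\<^sup>2 * quad_form L (Q_mat \<X>) w \<le> 0" using qw by (intro mult_nonneg_nonpos) auto
    ultimately show ?thesis by linarith
  qed
  finally show False by simp
qed

theorem proposition2p2:
  fixes I :: "'a set" and \<X> :: "'a set set"
  assumes "finite I"
    and "\<X> \<noteq> {}"
    and "\<X> \<subseteq> Pow I"
    and "pairwise (\<lambda>X Y. card (X \<inter> Y) \<le> 1) \<X>"
  shows "((\<forall>K\<in>components I \<X>. finite_type K (Q_mat \<X>) \<or> affine_type K (Q_mat \<X>)) \<and>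
          \<not> (\<exists>!K\<^sub>0. K\<^sub>0 \<in> components I \<X> \<and> indefinite_type K\<^sub>0 (Q_mat \<X>) \<and>
                (\<forall>K\<in>components I \<X>. K \<noteq> K\<^sub>0 \<longrightarrow> finite_type K (Q_mat \<X>))))
       \<or> (\<not> (\<forall>K\<in>components I \<X>. finite_type K (Q_mat \<X>) \<or> affine_type K (Q_mat \<X>)) \<and>
          (\<exists>!K\<^sub>0. K\<^sub>0 \<in> components I \<X> \<and> indefinite_type K\<^sub>0 (Q_mat \<X>) \<and>
                (\<forall>K\<in>components I \<X>. K \<noteq> K\<^sub>0 \<longrightarrow> finite_type K (Q_mat \<X>))))"
proof -
  let ?Q = "Q_mat \<X>" and ?\<Pi> = "components I \<X>"
  have sub: "K \<subseteq> I" if "K \<in> ?\<Pi>" for K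
    using partition_onD1[OF partition_on_components[of I \<X>]] that by blast
  have finK: "finite K" if "K \<in> ?\<Pi>" for K using sub[OF that] assms(1) by (rule finite_subset)
  have ind: "indecomposable K ?Q" if "K \<in> ?\<Pi>" for K
    using indecomposable_components[OF assms(1,3,4) that] .
  have ne: "K \<noteq> {}" if "K \<in> ?\<Pi>" for K using ind[OF that] by (simp add: indecomposable_def)
  have off: "?Q i j \<le> 0" if "K \<in> ?\<Pi>" "i \<in> K" "j \<in> K" "i \<noteq> j" for K i j
    using Q_mat_offdiag[OF assms(1,3,4), of i j] sub[OF that(1)] that
    by (auto simp: subset_iff)
  have tri: "finite_type K ?Q \<or> affine_type K ?Q \<or> indefinite_type K ?Q" if "K \<in> ?\<Pi>" for K
    using vinberg_trichotomy[OF finK[OF that] Q_mat_sym off[OF that] ind[OF that]] by blast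
  have excl: "\<not> finite_type K ?Q \<and> \<not> affine_type K ?Q" if K: "K \<in> ?\<Pi>" "indefinite_type K ?Q" for K
  proof -
    obtain u where "u \<in> vecs K" "u \<noteq> 0" "quad_form K ?Q u < 0"
      using indefinite_type_negative_vector[OF finK[OF K(1)] ne[OF K(1)] K(2)] by blast
    then show ?thesis
      by (force simp: finite_type_def pos_def_def affine_type_def pos_semidef_def)
  qed
  have other: "finite_type L ?Q"
    if K: "K \<in> ?\<Pi>" "indefinite_type K ?Q" and L: "L \<in> ?\<Pi>" "L \<noteq> K" for K L
  proof -
    obtain u where u: "u \<in> vecs K" "quad_form K ?Q u < 0"
      using indefinite_type_negative_vector[OF finK[OF K(1)] ne[OF K(1)] K(2)] by blast
    have disj: "K \<inter> L = {}"
      using partition_onD2[OF partition_on_components[of I \<X>]] K L by (auto simp: disjoint_def)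
    have "quad_form L ?Q v > 0" if "v \<in> vecs L" "v \<noteq> 0" for v
      using quad_form_pos_on_other_block[OF finK[OF K(1)] finK[OF L(1)] disj _ off[OF L(1)] u that]
        Q_mat_block[OF assms(1,3,4) K(1) L(1) L(2)[symmetric]] by blast
    then show ?thesis by (simp add: finite_type_def pos_def_def)
  qed
  show ?thesis
  proof (cases "\<exists>K\<in>?\<Pi>. indefinite_type K ?Q")
    case True
    then obtain K where K: "K \<in> ?\<Pi>" "indefinite_type K ?Q" by blast
    have "\<exists>!K\<^sub>0. K\<^sub>0 \<in> ?\<Pi> \<and> indefinite_type K\<^sub>0 ?Q \<and> (\<forall>L\<in>?\<Pi>. L \<noteq> K\<^sub>0 \<longrightarrow> finite_type L ?Q)"
    proof (rule ex1I[of _ K])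
      show "K \<in> ?\<Pi> \<and> indefinite_type K ?Q \<and> (\<forall>L\<in>?\<Pi>. L \<noteq> K \<longrightarrow> finite_type L ?Q)"
        using K other[OF K] by simp
    next
      fix L assume "L \<in> ?\<Pi> \<and> indefinite_type L ?Q \<and> (\<forall>M\<in>?\<Pi>. M \<noteq> L \<longrightarrow> finite_type M ?Q)"
      then show "L = K" using K(1) excl[OF K] by metis
    qed
    moreover have "\<not> (\<forall>K\<in>?\<Pi>. finite_type K ?Q \<or> affine_type K ?Q)"
      using K(1) excl[OF K] by blast
    ultimately show ?thesis by (intro disjI2 conjI)
  next
    case False
    then have "\<not> (\<exists>!K\<^sub>0. K\<^sub>0 \<in> ?\<Pi> \<and> indefinite_type K\<^sub>0 ?Q \<and> (\<forall>L\<in>?\<Pi>. L \<noteq> K\<^sub>0 \<longrightarrow> finite_type L ?Q))"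
      by (auto elim!: ex1E)
    moreover have "\<forall>K\<in>?\<Pi>. finite_type K ?Q \<or> affine_type K ?Q" using tri False by blast
    ultimately show ?thesis by (intro disjI1 conjI)
  qed
qed

end
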